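(* Let $R$ be an almost weakly Baer ring. Then $R$, with the reduced ring order $\le_{\mathrm{rr}}$, is a lower semi-lattice (i.e., $R$ is rr-good) if and only if $R$ is a weakly Baer ring.
   Context: All rings are unitary (not necessarily commutative) and reduced (no non-zero nilpotent elements). In a reduced ring $R$ all idempotents are central, and the left and right annihilators of an element $r$ coincide; this common ideal is denoted $\mathrm{ann}\, r$. $\mathbf{B}(R)$ denotes the set (Boolean algebra) of idempotents of $R$. The reduced ring order (rr-order) on $R$ is the partial order $a\le_{\mathrm{rr}} b$ if and only if $ab=a^2$. $R$ is called rr-good if every pair $a,b\in R$ has an infimum $a\wedge_{\mathrm{rr}} b$ in this order. A reduced ring $R$ is almost weakly Baer (awB) if for each $r\in R$ the ideal $\mathrm{ann}\, r$ is generated by idempotents, i.e. $\mathrm{ann}\, r=(\mathrm{ann}\, r\cap \mathbf{B}(R))R$. A reduced ring $R$ is weakly Baer (wB) if for each $r\in R$ there is $e\in\mathbf{B}(R)$ with $\mathrm{ann}\, r=eR$. *)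

theory Defs
  imports "HOL-Algebra.Algebra"
begin

locale reduced_ring = ring R for R (structure) +
  assumes nilpotent_zero: "\<lbrakk>x \<in> carrier R; x [^] (n::nat) = \<zero>\<rbrakk> \<Longrightarrow> x = \<zero>"

definition idempotents :: "('a, 'b) ring_scheme \<Rightarrow> 'a set"
  where "idempotents R = {e \<in> carrier R. e \<otimes>\<^bsub>R\<^esub> e = e}"

text \<open>This is the right annihilator; in a reduced ring it is also the left one
  (lemma \<open>ann_left\<close> below).\<close>

definition ann :: "('a, 'b) ring_scheme \<Rightarrow> 'a \<Rightarrow> 'a set"
  where "ann R r = {x \<in> carrier R. r \<otimes>\<^bsub>R\<^esub> x = \<zero>\<^bsub>R\<^esub>}"

definition rr_order :: "('a, 'b) ring_scheme \<Rightarrow> 'a gorder"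
  where "rr_order R =
    \<lparr>carrier = carrier R, eq = (=), le = (\<lambda>a b. a \<otimes>\<^bsub>R\<^esub> b = a \<otimes>\<^bsub>R\<^esub> a)\<rparr>"

definition rr_good :: "('a, 'b) ring_scheme \<Rightarrow> bool"
  where "rr_good R \<longleftrightarrow> reduced_ring R \<and>
    (\<forall>a \<in> carrier R. \<forall>b \<in> carrier R.
      \<exists>i. greatest (rr_order R) i (Lower (rr_order R) {a, b}))"

text \<open>The two-sided ideal generated by the idempotents in \<open>ann R r\<close> is the set of products
  of these idempotents with ring elements (lemma \<open>Idl_ann_idempotents\<close> below).\<close>

definition almost_weakly_Baer :: "('a, 'b) ring_scheme \<Rightarrow> bool"
  where "almost_weakly_Baer R \<longleftrightarrow> reduced_ring R \<and>
    (\<forall>r \<in> carrier R. ann R r = Idl\<^bsub>R\<^esub> (ann R r \<inter> idempotents R))"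

definition weakly_Baer :: "('a, 'b) ring_scheme \<Rightarrow> bool"
  where "weakly_Baer R \<longleftrightarrow> reduced_ring R \<and>
    (\<forall>r \<in> carrier R. \<exists>e \<in> idempotents R. ann R r = e <#\<^bsub>R\<^esub> carrier R)"

context reduced_ring
begin

lemma square_zero:
  assumes "x \<in> carrier R" "x \<otimes> x = \<zero>"
  shows "x = \<zero>"
  using nilpotent_zero[of x 2] assms by (simp add: numeral_2_eq_2)

lemma mult_zero_commute:
  assumes x: "x \<in> carrier R" and y: "y \<in> carrier R" and xy: "x \<otimes> y = \<zero>"
  shows "y \<otimes> x = \<zero>"
proof (rule square_zero)
  have "(y \<otimes> x) \<otimes> (y \<otimes> x) = y \<otimes> (x \<otimes> y) \<otimes> x"
    using x y by (simp add: m_assoc)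
  then show "(y \<otimes> x) \<otimes> (y \<otimes> x) = \<zero>" using x y xy by simp
qed (use x y in simp)

lemma mult_zero_insert:
  assumes x: "x \<in> carrier R" and y: "y \<in> carrier R" and z: "z \<in> carrier R"
    and xy: "x \<otimes> y = \<zero>"
  shows "x \<otimes> z \<otimes> y = \<zero>"
proof (rule square_zero)
  have "(x \<otimes> z \<otimes> y) \<otimes> (x \<otimes> z \<otimes> y) = x \<otimes> z \<otimes> (y \<otimes> x) \<otimes> (z \<otimes> y)"
    using x y z by (simp add: m_assoc)
  then show "(x \<otimes> z \<otimes> y) \<otimes> (x \<otimes> z \<otimes> y) = \<zero>"
    using x y z mult_zero_commute[OF x y xy] by simp
qed (use x y z in simp)

lemma ann_left:
  assumes "r \<in> carrier R"
  shows "ann R r = {x \<in> carrier R. x \<otimes> r = \<zero>}"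
  using assms mult_zero_commute unfolding ann_def by blast

lemma mult_minus_zero_iff:
  assumes "a \<in> carrier R" "b \<in> carrier R" "c \<in> carrier R"
  shows "a \<otimes> (b \<ominus> c) = \<zero> \<longleftrightarrow> a \<otimes> b = a \<otimes> c"
proof -
  have "a \<otimes> (b \<ominus> c) = a \<otimes> b \<ominus> a \<otimes> c"
    using assms by (simp add: a_minus_def r_distr r_minus)
  then show ?thesis using assms by simp
qed

lemma minus_mult_zero_iff:
  assumes "a \<in> carrier R" "b \<in> carrier R" "c \<in> carrier R"
  shows "(b \<ominus> c) \<otimes> a = \<zero> \<longleftrightarrow> b \<otimes> a = c \<otimes> a"
proof -
  have "(b \<ominus> c) \<otimes> a = b \<otimes> a \<ominus> c \<otimes> a"
    using assms by (simp add: a_minus_def l_distr l_minus)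
  then show ?thesis using assms by simp
qed

lemma idempotent_central:
  assumes e: "e \<in> idempotents R" and x: "x \<in> carrier R"
  shows "e \<otimes> x = x \<otimes> e"
proof -
  have ec: "e \<in> carrier R" and ee: "e \<otimes> e = e" using e by (auto simp: idempotents_def)
  have m: "\<one> \<ominus> e \<in> carrier R" using ec by simp
  have 1: "e \<otimes> (\<one> \<ominus> e) = \<zero>" using ec ee by (simp add: mult_minus_zero_iff)
  have "e \<otimes> x \<otimes> (\<one> \<ominus> e) = \<zero>" using mult_zero_insert[OF ec m x 1] .
  then have a: "e \<otimes> x = e \<otimes> x \<otimes> e" using ec x by (simp add: mult_minus_zero_iff)
  have "(\<one> \<ominus> e) \<otimes> x \<otimes> e = \<zero>"
    using mult_zero_insert[OF m ec x mult_zero_commute[OF ec m 1]] .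
  then have "(\<one> \<ominus> e) \<otimes> (x \<otimes> e) = \<zero>" using ec x m by (simp add: m_assoc)
  then have "x \<otimes> e = e \<otimes> (x \<otimes> e)" using ec x by (simp add: minus_mult_zero_iff)
  with a show ?thesis using ec x by (simp add: m_assoc)
qed

lemma Idl_ann_idempotents:
  assumes r: "r \<in> carrier R"
  shows "Idl (ann R r \<inter> idempotents R) =
    {e \<otimes> x | e x. e \<in> ann R r \<inter> idempotents R \<and> x \<in> carrier R}"
    (is "Idl ?S = ?J")
proof
  have Sc: "?S \<subseteq> carrier R" by (auto simp: idempotents_def)
  have eS: "e \<in> carrier R \<and> e \<otimes> e = e \<and> r \<otimes> e = \<zero>" if "e \<in> ?S" for e
    using that by (auto simp: ann_def idempotents_def)
  have "?S \<subseteq> ?J"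
  proof
    fix e assume "e \<in> ?S"
    then show "e \<in> ?J" using eS[of e] by (auto intro!: exI[of _ e])
  qed
  moreover have "ideal ?J R"
  proof (rule idealI)
    show "ring R" by (rule ring_axioms)
    show "subgroup ?J (add_monoid R)"
    proof
      show "?J \<subseteq> carrier (add_monoid R)" using eS by auto
      have "\<zero> \<in> ?S" using r by (auto simp: ann_def idempotents_def)
      then show "\<one>\<^bsub>add_monoid R\<^esub> \<in> ?J" by force
    next
      fix u v assume "u \<in> ?J" "v \<in> ?J"
      then obtain e x f y where e: "e \<in> ?S" and f: "f \<in> ?S"
        and x: "x \<in> carrier R" and y: "y \<in> carrier R"
        and u: "u = e \<otimes> x" and v: "v = f \<otimes> y" by blast
      note ec = eS[OF e] and fc = eS[OF f]
      have ef: "f \<otimes> e = e \<otimes> f"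
        using idempotent_central[of f e] f ec by auto
      define g where "g = e \<oplus> (f \<ominus> e \<otimes> f)"
      have gc: "g \<in> carrier R" using ec fc by (simp add: g_def)
      have ff: "f \<otimes> (f \<otimes> z) = f \<otimes> z" "e \<otimes> (e \<otimes> z) = e \<otimes> z" "f \<otimes> (e \<otimes> z) = e \<otimes> (f \<otimes> z)"
        if "z \<in> carrier R" for z
        using that ec fc ef by (simp_all add: m_assoc[symmetric])
      have ge: "g \<otimes> e = e"
        using ec fc ef by (simp add: g_def l_distr a_minus_def l_minus m_assoc ff r_neg)
      have gf: "g \<otimes> f = f"
        using ec fc ef by (simp add: g_def l_distr a_minus_def l_minus m_assoc ff r_neg a_ac r_neg1 r_neg2)
      have rg: "r \<otimes> g = \<zero>"
        using ec fc r by (simp add: g_def r_distr a_minus_def r_minus m_assoc[symmetric])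
      have "g \<otimes> g = (g \<otimes> e) \<oplus> (g \<otimes> f \<ominus> g \<otimes> e \<otimes> f)"
        using ec fc gc by (subst (2) g_def) (simp add: r_distr a_minus_def r_minus m_assoc)
      then have gg: "g \<otimes> g = g" by (simp only: ge gf g_def[symmetric])
      have "g \<otimes> (u \<oplus> v) = g \<otimes> e \<otimes> x \<oplus> g \<otimes> f \<otimes> y"
        using ec fc gc x y by (simp add: u v r_distr m_assoc)
      then have "u \<oplus> v = g \<otimes> (u \<oplus> v)" by (simp add: ge gf u v)
      moreover have "g \<in> ?S" using gc gg rg by (auto simp: ann_def idempotents_def)
      moreover have "u \<oplus> v \<in> carrier R" using ec fc x y u v by simp
      ultimately show "u \<otimes>\<^bsub>add_monoid R\<^esub> v \<in> ?J" by auto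
    next
      fix u assume "u \<in> ?J"
      then obtain e x where e: "e \<in> ?S" and x: "x \<in> carrier R" and u: "u = e \<otimes> x" by blast
      have "\<ominus> u = e \<otimes> (\<ominus> x)" using eS[OF e] x u by (simp add: r_minus)
      then have "\<ominus> u \<in> ?J" using e x by blast
      then show "inv\<^bsub>add_monoid R\<^esub> u \<in> ?J" by (simp add: a_inv_def)
    qed
  next
    fix u z assume "u \<in> ?J" and z: "z \<in> carrier R"
    then obtain e x where e: "e \<in> ?S" and x: "x \<in> carrier R" and u: "u = e \<otimes> x" by blast
    have ec: "e \<in> carrier R" using eS[OF e] by simp
    have "u \<otimes> z = e \<otimes> (x \<otimes> z)" using ec x z u by (simp add: m_assoc)
    then show "u \<otimes> z \<in> ?J" using e x z by blast
    have "z \<otimes> u = e \<otimes> (z \<otimes> x)"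
      using ec x z u idempotent_central[of e z] e by (simp add: m_assoc[symmetric])
    then show "z \<otimes> u \<in> ?J" using e x z by blast
  qed
  ultimately show "Idl ?S \<subseteq> ?J" by (rule genideal_minimal[rotated])
  show "?J \<subseteq> Idl ?S"
    using genideal_self[OF Sc] ideal.I_r_closed[OF genideal_ideal[OF Sc]] by blast
qed

lemma rr_partial_order: "partial_order (rr_order R)"
proof -
  have anti: "a = b" if ab: "a \<in> carrier R" "b \<in> carrier R"
    "a \<otimes> b = a \<otimes> a" "b \<otimes> a = b \<otimes> b" for a b
  proof -
    have "a \<otimes> (a \<ominus> b) = \<zero>" "b \<otimes> (a \<ominus> b) = \<zero>"
      using ab by (simp_all add: mult_minus_zero_iff)
    then have "(a \<ominus> b) \<otimes> (a \<ominus> b) = \<zero>"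
      using minus_mult_zero_iff[of "a \<ominus> b" a b] ab(1,2) by simp
    then have "a \<ominus> b = \<zero>"
      by (rule square_zero[rotated]) (use ab(1,2) in simp)
    then show ?thesis using ab(1,2) by simp
  qed
  have trans: "a \<otimes> c = a \<otimes> a" if abc: "a \<in> carrier R" "b \<in> carrier R" "c \<in> carrier R"
    "a \<otimes> b = a \<otimes> a" "b \<otimes> c = b \<otimes> b" for a b c
  proof -
    have m: "b \<ominus> c \<in> carrier R" using abc by simp
    have "b \<otimes> (b \<ominus> c) = \<zero>" using abc by (simp add: mult_minus_zero_iff)
    then have "a \<otimes> (b \<otimes> (b \<ominus> c)) = \<zero>" using abc by simp
    then have "(a \<otimes> a) \<otimes> (b \<ominus> c) = \<zero>" using abc m by (simp add: m_assoc[symmetric])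
    then have "a \<otimes> (a \<otimes> (b \<ominus> c)) = \<zero>" using abc m by (simp add: m_assoc)
    then have "a \<otimes> (b \<ominus> c) \<otimes> a = \<zero>"
      by (rule mult_zero_commute[rotated 2]) (use abc(1) m in simp_all)
    then have "a \<otimes> (b \<ominus> c) \<otimes> a \<otimes> (b \<ominus> c) = \<zero>" using m by simp
    then have "(a \<otimes> (b \<ominus> c)) \<otimes> (a \<otimes> (b \<ominus> c)) = \<zero>" using abc m by (simp add: m_assoc)
    then have "a \<otimes> (b \<ominus> c) = \<zero>"
      by (rule square_zero[rotated]) (use abc(1) m in simp)
    then show ?thesis using abc by (simp add: mult_minus_zero_iff)
  qed
  show ?thesis
  proof unfold_locales
    fix x y z assume "x \<sqsubseteq>\<^bsub>rr_order R\<^esub> y" "y \<sqsubseteq>\<^bsub>rr_order R\<^esub> z" "x \<in> carrier (rr_order R)"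
      "y \<in> carrier (rr_order R)" "z \<in> carrier (rr_order R)"
    then show "x \<sqsubseteq>\<^bsub>rr_order R\<^esub> z"
      using trans[of x y z] by (simp add: rr_order_def)
  next
    fix x y assume "x \<sqsubseteq>\<^bsub>rr_order R\<^esub> y" "y \<sqsubseteq>\<^bsub>rr_order R\<^esub> x" "x \<in> carrier (rr_order R)"
      "y \<in> carrier (rr_order R)"
    then show "x .=\<^bsub>rr_order R\<^esub> y"
      using anti[of x y] by (simp add: rr_order_def)
  qed (simp_all add: rr_order_def)
qed

lemma lower_semilattice_rr_order_iff: "lower_semilattice (rr_order R) \<longleftrightarrow> rr_good R"
proof -
  have "carrier (rr_order R) = carrier R" by (simp add: rr_order_def)
  then show ?thesis
    using rr_partial_order reduced_ring_axioms
    by (auto simp: lower_semilattice_def lower_semilattice_axioms_def rr_good_def)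
qed

end

end

(* The lower bounds of \<one> and \<one> \<ominus> r are exactly the idempotents annihilating r, so their
   infimum generates ann r as soon as ann r is generated by idempotents. Conversely, if
   ann (a \<ominus> b) = e R, then every common lower bound of a and b lies in e R, and the
   infimum of a and b is e a = e b. *)

theory Submission
  imports Defs
begin

context reduced_ring
begin

text \<open>Unfolds the order once, so that both directions can argue with ring equations
  alone.\<close>

lemma greatest_Lower_rr_order_iff:
  assumes a: "a \<in> carrier R" and b: "b \<in> carrier R"
  shows "greatest (rr_order R) i (Lower (rr_order R) {a, b}) \<longleftrightarrow>
    i \<in> carrier R \<and> i \<otimes> a = i \<otimes> i \<and> i \<otimes> b = i \<otimes> i \<and>
    (\<forall>c \<in> carrier R. c \<otimes> a = c \<otimes> c \<and> c \<otimes> b = c \<otimes> c \<longrightarrow> c \<otimes> i = c \<otimes> c)"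
  using a b by (auto simp: greatest_def Lower_def rr_order_def)

text \<open>Lying below \<open>\<one>\<close> is idempotency, \<open>c = c \<otimes> c\<close>.
  Given this, lying below \<open>\<one> \<ominus> r\<close> reads
  \<open>c \<ominus> c \<otimes> r = c\<close>, and cancelling \<open>c\<close> leaves
  \<open>c \<otimes> r = \<zero>\<close>.\<close>

lemma rr_lower_bound_one_one_minus_iff:
  assumes c: "c \<in> carrier R" and r: "r \<in> carrier R"
  shows "c \<otimes> \<one> = c \<otimes> c \<and> c \<otimes> (\<one> \<ominus> r) = c \<otimes> c \<longleftrightarrow> c \<in> ann R r \<inter> idempotents R"
proof -
  have "c \<otimes> (\<one> \<ominus> r) = c \<longleftrightarrow> c \<otimes> r = \<zero>"
  proof -
    have "c \<otimes> (\<one> \<ominus> r) = c \<ominus> c \<otimes> r"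
      using c r by (simp add: a_minus_def r_distr r_minus)
    moreover have "c \<otimes> r = \<zero>" if d: "c \<ominus> c \<otimes> r = c"
    proof -
      have "c \<oplus> c \<otimes> r = (c \<ominus> c \<otimes> r) \<oplus> c \<otimes> r" by (simp only: d)
      also have "\<dots> = c" using c r by (simp add: a_minus_def a_assoc l_neg)
      finally show ?thesis using c r add.l_cancel_one'[of c "c \<otimes> r"] by simp
    qed
    moreover have "c \<ominus> \<zero> = c" using c by (simp add: a_minus_def)
    ultimately show ?thesis by metis
  qed
  then show ?thesis
    using c r by (auto simp: ann_left idempotents_def)
qed

lemma infimum_of_ann_minus_generator:
  assumes a: "a \<in> carrier R" and b: "b \<in> carrier R" and e: "e \<in> idempotents R"
    and ann: "ann R (a \<ominus> b) = e <# carrier R"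
  shows "greatest (rr_order R) (e \<otimes> a) (Lower (rr_order R) {a, b})"
proof -
  have ec: "e \<in> carrier R" and ee: "e \<otimes> e = e" using e by (auto simp: idempotents_def)
  have m: "a \<ominus> b \<in> carrier R" using a b by simp
  \<comment> \<open>The generator annihilates \<open>a \<ominus> b\<close> because it lies in its
    own coset, as \<open>e = e \<otimes> e\<close>.\<close>
  have "e \<in> e <# carrier R" using ec ee by (auto simp: l_coset_def intro!: bexI[of _ e])
  then have "e \<otimes> (a \<ominus> b) = \<zero>" using ann ann_left[OF m] by auto
  then have eab: "e \<otimes> a = e \<otimes> b" using ec a b by (simp add: mult_minus_zero_iff)
  \<comment> \<open>In the rr-order this is \<open>e \<otimes> x \<le> x\<close>. Applied to
    \<open>a\<close> and to \<open>b\<close>, and combined with \<open>eab\<close>, it makes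
    \<open>e \<otimes> a\<close> a common lower bound.\<close>
  have sq: "e \<otimes> x \<otimes> x = e \<otimes> x \<otimes> (e \<otimes> x)" if x: "x \<in> carrier R" for x
  proof -
    have "e \<otimes> x \<otimes> (e \<otimes> x) = e \<otimes> (x \<otimes> e) \<otimes> x" using ec x by (simp add: m_assoc)
    also have "\<dots> = e \<otimes> e \<otimes> x \<otimes> x"
      using ec x idempotent_central[OF e x] by (simp add: m_assoc)
    finally show ?thesis using ee by simp
  qed
  have "c \<otimes> (e \<otimes> a) = c \<otimes> c"
    if c: "c \<in> carrier R" and ca: "c \<otimes> a = c \<otimes> c" and cb: "c \<otimes> b = c \<otimes> c" for c
  proof -
    have "c \<otimes> (a \<ominus> b) = \<zero>" using a b c ca cb by (simp add: mult_minus_zero_iff)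
    then have "c \<in> e <# carrier R" using c ann ann_left[OF m] by auto
    then obtain x where x: "x \<in> carrier R" "c = e \<otimes> x" by (auto simp: l_coset_def)
    \<comment> \<open>An idempotent acts as the identity on its coset; centrality then moves
      \<open>e\<close> to the right, so that \<open>c \<otimes> (e \<otimes> a)\<close> collapses to
      \<open>c \<otimes> a\<close>.\<close>
    have "e \<otimes> c = c" using x(1) ec ee unfolding x(2) by (simp flip: m_assoc)
    then have "c \<otimes> e = c" using idempotent_central[OF e c] by simp
    then show ?thesis using a c ec ca by (simp add: m_assoc[symmetric])
  qed
  moreover have "e \<otimes> a \<otimes> b = e \<otimes> a \<otimes> (e \<otimes> a)" using sq[OF b] eab by simp
  ultimately show ?thesis
    unfolding greatest_Lower_rr_order_iff[OF a b] using sq[OF a] m_closed[OF ec a] by blast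
qed

lemma rr_good_if_weakly_Baer:
  assumes "weakly_Baer R"
  shows "rr_good R"
  unfolding rr_good_def
proof (intro conjI ballI)
  fix a b assume a: "a \<in> carrier R" and b: "b \<in> carrier R"
  then have "a \<ominus> b \<in> carrier R" by simp
  then obtain e where "e \<in> idempotents R" "ann R (a \<ominus> b) = e <# carrier R"
    using assms unfolding weakly_Baer_def by blast
  then show "\<exists>i. greatest (rr_order R) i (Lower (rr_order R) {a, b})"
    using infimum_of_ann_minus_generator a b by blast
qed (rule reduced_ring_axioms)

lemma weakly_Baer_if_rr_good:
  assumes awB: "almost_weakly_Baer R" and good: "rr_good R"
  shows "weakly_Baer R"
  unfolding weakly_Baer_def
proof (intro conjI ballI)
  fix r assume r: "r \<in> carrier R"
  let ?S = "ann R r \<inter> idempotents R"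
  have m: "\<one> \<ominus> r \<in> carrier R" using r by simp
  \<comment> \<open>The pair has difference \<open>r\<close>, as \<open>a \<ominus> b\<close> has in
    the converse, and the entry \<open>\<one>\<close> forces its lower bounds to be
    idempotent.\<close>
  obtain e where "greatest (rr_order R) e (Lower (rr_order R) {\<one>, \<one> \<ominus> r})"
    using good m unfolding rr_good_def by blast
  then have e: "e \<in> carrier R" "e \<otimes> \<one> = e \<otimes> e \<and> e \<otimes> (\<one> \<ominus> r) = e \<otimes> e"
    and max: "\<And>c. c \<in> carrier R \<Longrightarrow> c \<otimes> \<one> = c \<otimes> c \<and> c \<otimes> (\<one> \<ominus> r) = c \<otimes> c
      \<Longrightarrow> c \<otimes> e = c \<otimes> c"
    unfolding greatest_Lower_rr_order_iff[OF one_closed m] by blast+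
  have eS: "e \<in> ?S" using e rr_lower_bound_one_one_minus_iff[OF e(1) r] by blast
  \<comment> \<open>For idempotent \<open>f\<close>, the maximality \<open>f \<le> e\<close> says
    \<open>f \<otimes> e = f\<close>: the infimum absorbs every idempotent of the
    annihilator.\<close>
  have fe: "e \<otimes> f = f" if f: "f \<in> ?S" for f
  proof -
    have fc: "f \<in> carrier R" and ff: "f \<otimes> f = f" using f by (auto simp: idempotents_def)
    have "f \<otimes> e = f"
      using max[OF fc] f rr_lower_bound_one_one_minus_iff[OF fc r] ff by simp
    then show ?thesis using idempotent_central[of e f] eS fc by simp
  qed
  \<comment> \<open>Elements of the generated ideal are single products rather than sums, so
    \<open>fe\<close> alone puts each of them into the coset of \<open>e\<close>.\<close>
  have "ann R r = {f \<otimes> x | f x. f \<in> ?S \<and> x \<in> carrier R}"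
    using awB r Idl_ann_idempotents[OF r] unfolding almost_weakly_Baer_def by simp
  also have "\<dots> = e <# carrier R"
  proof
    show "{f \<otimes> x | f x. f \<in> ?S \<and> x \<in> carrier R} \<subseteq> e <# carrier R"
    proof
      fix y assume "y \<in> {f \<otimes> x | f x. f \<in> ?S \<and> x \<in> carrier R}"
      then obtain f x where f: "f \<in> ?S" and x: "x \<in> carrier R" and y: "y = f \<otimes> x" by blast
      have fc: "f \<in> carrier R" using f by (simp add: idempotents_def)
      have "y = e \<otimes> (f \<otimes> x)" using fe[OF f] e(1) fc x y by (simp add: m_assoc[symmetric])
      then show "y \<in> e <# carrier R" using fc x by (auto simp: l_coset_def)
    qed
    show "e <# carrier R \<subseteq> {f \<otimes> x | f x. f \<in> ?S \<and> x \<in> carrier R}"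
      using eS by (auto simp: l_coset_def)
  qed
  finally show "\<exists>e \<in> idempotents R. ann R r = e <# carrier R" using eS by blast
qed (rule reduced_ring_axioms)

end

theorem theorem2p6:
  fixes R :: "('a, 'b) ring_scheme"
  assumes "almost_weakly_Baer R"
  shows "lower_semilattice (rr_order R) \<longleftrightarrow> weakly_Baer R"
proof -
  interpret reduced_ring R using assms by (simp add: almost_weakly_Baer_def)
  show ?thesis
    using lower_semilattice_rr_order_iff rr_good_if_weakly_Baer weakly_Baer_if_rr_good[OF assms]
    by blast
qed

end
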